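(* For every positive integer $n$ and every odd positive integer $m=2k+1$, $$N(SO(2n+1),m)=\binom{n+[m/2]}{[m/2]}.$$
   Context: $SO(N)$ is the group of real $N\times N$ orthogonal matrices of determinant $1$. $N(G,m)$ denotes the number of conjugacy classes of $G$ (under conjugation by elements of $G$) contained in $\{x\in G: x^m=1\}$. $[\cdot]$ denotes the integer part (floor). *)

theory Defs
  imports "Jordan_Normal_Form.Determinant" "HOL-Algebra.Group_Action"
begin

text \<open>The predicate \<open>orthogonal_mat\<close> of \<open>Jordan_Normal_Form\<close> only asks for pairwise orthogonal
  nonzero columns, so orthogonality is spelled out here as \<open>A\<^sup>T A = 1\<close>.\<close>

definition SO :: "nat \<Rightarrow> real mat monoid" where
  "SO N = \<lparr>carrier = {A \<in> carrier_mat N N. transpose_mat A * A = 1\<^sub>m N \<and> det A = 1},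
           mult = (*), one = 1\<^sub>m N\<rparr>"

lemma group_SO: "group (SO N)"
proof (rule groupI)
  fix A B
  assume "A \<in> carrier (SO N)" "B \<in> carrier (SO N)"
  then have A: "A \<in> carrier_mat N N" "transpose_mat A * A = 1\<^sub>m N" "det A = 1"
    and B: "B \<in> carrier_mat N N" "transpose_mat B * B = 1\<^sub>m N" "det B = 1"
    by (auto simp: SO_def)
  have "transpose_mat (A * B) * (A * B) = transpose_mat B * transpose_mat A * (A * B)"
    using A(1) B(1) by (simp add: transpose_mult)
  also have "\<dots> = transpose_mat B * (transpose_mat A * (A * B))"
    using A(1) B(1) by (intro assoc_mult_mat[of _ N N _ N _ N]) auto
  also have "transpose_mat A * (A * B) = transpose_mat A * A * B"
    using A(1) B(1) by (intro assoc_mult_mat[of _ N N _ N _ N, symmetric]) auto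
  finally have "transpose_mat (A * B) * (A * B) = 1\<^sub>m N"
    using A B by simp
  then show "A \<otimes>\<^bsub>SO N\<^esub> B \<in> carrier (SO N)"
    using A B by (auto simp: SO_def det_mult)
next
  show "\<one>\<^bsub>SO N\<^esub> \<in> carrier (SO N)"
    by (simp add: SO_def)
next
  fix A B C
  assume "A \<in> carrier (SO N)" "B \<in> carrier (SO N)" "C \<in> carrier (SO N)"
  then show "A \<otimes>\<^bsub>SO N\<^esub> B \<otimes>\<^bsub>SO N\<^esub> C = A \<otimes>\<^bsub>SO N\<^esub> (B \<otimes>\<^bsub>SO N\<^esub> C)"
    by (auto simp: SO_def intro!: assoc_mult_mat[of _ N N _ N _ N])
next
  fix A
  assume "A \<in> carrier (SO N)"
  then show "\<one>\<^bsub>SO N\<^esub> \<otimes>\<^bsub>SO N\<^esub> A = A"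
    by (auto simp: SO_def)
next
  fix A
  assume "A \<in> carrier (SO N)"
  then have A: "A \<in> carrier_mat N N" "transpose_mat A * A = 1\<^sub>m N" "det A = 1"
    by (auto simp: SO_def)
  have "A * transpose_mat A = 1\<^sub>m N"
    using A by (intro mat_mult_left_right_inverse[of "transpose_mat A" N A]) auto
  then have "transpose_mat A \<in> carrier (SO N)"
    using A by (auto simp: SO_def det_transpose)
  then show "\<exists>B\<in>carrier (SO N). B \<otimes>\<^bsub>SO N\<^esub> A = \<one>\<^bsub>SO N\<^esub>"
    using A(2) by (intro bexI[of _ "transpose_mat A"]) (simp_all add: SO_def)
qed

definition conjugacy_classes :: "('a, 'b) monoid_scheme \<Rightarrow> 'a set set" where
  "conjugacy_classes G =
     orbits G (carrier G) (\<lambda>g. \<lambda>h\<in>carrier G. g \<otimes>\<^bsub>G\<^esub> h \<otimes>\<^bsub>G\<^esub> inv\<^bsub>G\<^esub> g)"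

text \<open>\<open>card\<close> is \<open>0\<close> on infinite sets, so only a nonzero value of \<open>num_classes G m\<close>
  is guaranteed to be a genuine count.\<close>

definition num_classes :: "('a, 'b) monoid_scheme \<Rightarrow> nat \<Rightarrow> nat" where
  "num_classes G m =
     card {C \<in> conjugacy_classes G. C \<subseteq> {x \<in> carrier G. x [^]\<^bsub>G\<^esub> m = \<one>\<^bsub>G\<^esub>}}"

end

theory Submission
  imports Defs "Jordan_Normal_Form.Char_Poly"
begin

text \<open>Real orthogonal matrices with the same characteristic polynomial are orthogonally conjugate:
  the real and imaginary parts of an eigenvector for a common complex eigenvalue span an invariant
  subspace of dimension 1 or 2 on which the matrix takes a form depending only on the eigenvalue;
  split it off and cancel its characteristic polynomial. In odd dimension the conjugating matrix can
  be taken with determinant 1, so a conjugacy class is determined by its characteristic polynomial.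
  For \<open>x\<^sup>m = 1\<close> in \<open>SO(2n+1)\<close>, \<open>m = 2k+1\<close>, this polynomial is \<open>X - 1\<close> times a product of \<open>n\<close> factors
  \<open>X\<^sup>2 - 2 cos(2\<pi>j/m) X + 1\<close> with \<open>0 \<le> j \<le> k\<close>, where \<open>j = 0\<close> accounts for pairs of eigenvalues 1.
  Every multiset of \<open>n\<close> such indices occurs and is recovered from the product.\<close>

subsection \<open>Orthogonal similarity\<close>

lemma scalar_prod_self_eq_0:
  fixes v :: "real vec"
  assumes "v \<in> carrier_vec n"
  shows "v \<bullet> v = 0 \<longleftrightarrow> v = 0\<^sub>v n"
proof
  assume "v \<bullet> v = 0"
  then have "\<forall>i\<in>{0..<n}. v $ i * v $ i = 0"
    using assms by (subst sum_nonneg_eq_0_iff[symmetric]) (auto simp: scalar_prod_def)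
  then show "v = 0\<^sub>v n"
    using assms by (intro eq_vecI) auto
qed (use assms in auto)

lemma scalar_prod_self_ge_0:
  fixes v :: "real vec"
  shows "v \<bullet> v \<ge> 0"
  by (auto simp: scalar_prod_def intro: sum_nonneg)

text \<open>The transpose of \<open>V\<close>, padded with zero rows to a square matrix, is singular
  because \<open>r < d\<close> leaves a zero row; a normalised kernel vector is the required
  \<open>v\<close>. Since \<open>V\<close> is arbitrary, the lemma serves both to extend an
  orthonormal family and, applied to a transpose, to bound its size.\<close>

lemma ex_unit_vec_orthogonal_cols:
  fixes V :: "real mat"
  assumes V: "V \<in> carrier_mat d r" and "r < d"
  obtains v where "v \<in> carrier_vec d" "v \<bullet> v = 1" "\<And>j. j < r \<Longrightarrow> col V j \<bullet> v = 0"
proof -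
  define M where "M = mat d d (\<lambda>(i,j). if i < r then V $$ (j,i) else 0)"
  have M: "M \<in> carrier_mat d d" by (simp add: M_def)
  have "M = mat\<^sub>r d d (\<lambda>i. if i = d - 1 then 0\<^sub>v d else row M i)"
    using \<open>r < d\<close> by (intro eq_matI) (auto simp: M_def)
  then have "det M = 0"
    using M \<open>r < d\<close> det_row_0[of "d - 1" d "row M"] by fastforce
  then obtain w where w: "w \<in> carrier_vec d" "w \<noteq> 0\<^sub>v d" "M *\<^sub>v w = 0\<^sub>v d"
    using det_0_iff_vec_prod_zero[OF M] by blast
  have pos: "w \<bullet> w > 0"
    using w scalar_prod_self_ge_0[of w] scalar_prod_self_eq_0[OF w(1)] by linarith
  show thesis
  proof
    show "(1 / sqrt (w \<bullet> w)) \<cdot>\<^sub>v w \<in> carrier_vec d" using w by simp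
    show "((1 / sqrt (w \<bullet> w)) \<cdot>\<^sub>v w) \<bullet> ((1 / sqrt (w \<bullet> w)) \<cdot>\<^sub>v w) = 1"
      using w pos by (simp add: scalar_prod_smult_distrib[of _ d] smult_scalar_prod_distrib[of _ d])
    fix j assume j: "j < r"
    have "row M j = col V j"
      using j V \<open>r < d\<close> by (intro eq_vecI) (auto simp: M_def)
    moreover have "row M j \<bullet> w = (M *\<^sub>v w) $ j"
      using j M \<open>r < d\<close> by simp
    ultimately have "col V j \<bullet> w = 0"
      using w j \<open>r < d\<close> by simp
    then show "col V j \<bullet> ((1 / sqrt (w \<bullet> w)) \<cdot>\<^sub>v w) = 0"
      using w V by (simp add: scalar_prod_smult_distrib[of _ d])
  qed
qed

lemma transpose_mult_self_eq_1_iff: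
  fixes V :: "'a :: comm_semiring_1 mat"
  assumes V: "V \<in> carrier_mat d r"
  shows "transpose_mat V * V = 1\<^sub>m r \<longleftrightarrow>
    (\<forall>i<r. \<forall>j<r. col V i \<bullet> col V j = (if i = j then 1 else 0))" (is "?L \<longleftrightarrow> ?R")
proof
  assume L: ?L
  show ?R
  proof (intro allI impI)
    fix i j assume "i < r" "j < r"
    then have "col V i \<bullet> col V j = (transpose_mat V * V) $$ (i, j)"
      using V by simp
    then show "col V i \<bullet> col V j = (if i = j then 1 else 0)"
      using L \<open>i < r\<close> \<open>j < r\<close> by simp
  qed
next
  assume ?R
  then show ?L using V by (intro eq_matI) auto
qed

text \<open>Adjoin one unit vector orthogonal to the present columns at a time, by induction on the
  number \<open>d - r\<close> of missing columns.\<close>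

lemma orthonormal_completion:
  fixes V :: "real mat"
  assumes "V \<in> carrier_mat d r" "transpose_mat V * V = 1\<^sub>m r" "r \<le> d"
  shows "\<exists>W. W \<in> carrier_mat d d \<and> transpose_mat W * W = 1\<^sub>m d \<and> (\<forall>j<r. col W j = col V j)"
  using assms
proof (induction "d - r" arbitrary: r V)
  case 0
  then show ?case by auto
next
  case (Suc s)
  then have "r < d" by simp
  then obtain v where v: "v \<in> carrier_vec d" "v \<bullet> v = 1" "\<And>j. j < r \<Longrightarrow> col V j \<bullet> v = 0"
    using ex_unit_vec_orthogonal_cols Suc.prems(1) by blast
  have v': "v \<bullet> col V j = 0" if "j < r" for j
    using v(3)[OF that] comm_scalar_prod[OF v(1), of "col V j"] Suc.prems(1) by (metis col_carrier_vec that)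
  define V' where "V' = mat d (Suc r) (\<lambda>(i,j). if j < r then V $$ (i,j) else v $ i)"
  have V': "V' \<in> carrier_mat d (Suc r)" by (simp add: V'_def)
  have col1: "col V' j = col V j" if "j < r" for j
    using that Suc.prems(1) by (intro eq_vecI) (auto simp: V'_def)
  have col2: "col V' r = v"
    using v(1) by (intro eq_vecI) (auto simp: V'_def)
  have "transpose_mat V' * V' = 1\<^sub>m (Suc r)"
    using Suc.prems(2) v v' col1 col2
    unfolding transpose_mult_self_eq_1_iff[OF V'] transpose_mult_self_eq_1_iff[OF Suc.prems(1)]
    by (auto simp: less_Suc_eq)
  then obtain W where W: "W \<in> carrier_mat d d" "transpose_mat W * W = 1\<^sub>m d"
      "\<forall>j<Suc r. col W j = col V' j"
    using Suc.hyps(1)[OF _ V'] Suc.hyps(2) \<open>r < d\<close> by fastforce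
  then show ?case
    using col1 by (intro exI[of _ W]) auto
qed

text \<open>Taking the transpose as the inverse witness says that \<open>P\<close> is orthogonal and
  keeps the library facts on \<open>similar_mat_wit\<close> applicable. The sign of
  \<open>det P\<close> is left open; it is adjusted only at the end, in odd dimension.\<close>

definition orthogonally_similar :: "'a :: semiring_1 mat \<Rightarrow> 'a mat \<Rightarrow> bool" where
  "orthogonally_similar A B \<longleftrightarrow> (\<exists>P. similar_mat_wit A B P (transpose_mat P))"

lemma orthogonally_similar_sym: "orthogonally_similar A B \<Longrightarrow> orthogonally_similar B A"
  unfolding orthogonally_similar_def
  by (metis similar_mat_wit_sym transpose_transpose)

lemma orthogonally_similar_trans:
  fixes A B C :: "'a :: comm_semiring_1 mat"
  assumes "orthogonally_similar A B" "orthogonally_similar B C"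
  shows "orthogonally_similar A C"
proof -
  obtain P Q where P: "similar_mat_wit A B P (transpose_mat P)"
    and Q: "similar_mat_wit B C Q (transpose_mat Q)"
    using assms unfolding orthogonally_similar_def by blast
  define d where "d = dim_row A"
  have A: "A \<in> carrier_mat d d"
    using similar_mat_witD(4)[OF d_def P] .
  have Pc: "P \<in> carrier_mat d d" and B: "B \<in> carrier_mat d d"
    using similar_mat_witD2(5,6)[OF A P] by auto
  have Qc: "Q \<in> carrier_mat d d"
    using similar_mat_witD2(6)[OF B Q] .
  show ?thesis
    using similar_mat_wit_trans[OF P Q]
    unfolding orthogonally_similar_def transpose_mult[OF Pc Qc, symmetric] by blast
qed

text \<open>Conjugate by the block diagonal matrix of \<open>1\<close> and \<open>P\<close>. This
  lifts the induction hypothesis on the complement to the whole space.\<close>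

lemma orthogonally_similar_block:
  fixes B :: "'a :: comm_semiring_1 mat"
  assumes "orthogonally_similar X Y" "B \<in> carrier_mat r r" "X \<in> carrier_mat s s"
  shows "orthogonally_similar (four_block_mat B (0\<^sub>m r s) (0\<^sub>m s r) X)
    (four_block_mat B (0\<^sub>m r s) (0\<^sub>m s r) Y)"
proof -
  obtain P where P: "similar_mat_wit X Y P (transpose_mat P)"
    using assms(1) unfolding orthogonally_similar_def by blast
  have Pc: "P \<in> carrier_mat s s" "transpose_mat P \<in> carrier_mat s s"
    using similar_mat_witD2[OF assms(3) P] by auto
  have "similar_mat_wit (four_block_mat B (0\<^sub>m r s) (0\<^sub>m s r) X)
    (four_block_mat B (0\<^sub>m r s) (0\<^sub>m s r) Y)
    (four_block_mat (1\<^sub>m r) (0\<^sub>m r s) (0\<^sub>m s r) P)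
    (four_block_mat (1\<^sub>m r) (0\<^sub>m r s) (0\<^sub>m s r) (transpose_mat P))"
    by (rule similar_mat_wit_four_block[OF similar_mat_wit_refl[OF assms(2)] P _ _ assms(2,3)])
       (use Pc in auto)
  also have "four_block_mat (1\<^sub>m r) (0\<^sub>m r s) (0\<^sub>m s r) (transpose_mat P) =
      transpose_mat (four_block_mat (1\<^sub>m r) (0\<^sub>m r s) (0\<^sub>m s r) P)"
    using Pc by (subst transpose_four_block_mat[of _ r r _ s _ s]) auto
  finally show ?thesis unfolding orthogonally_similar_def by blast
qed

lemma orthogonally_similar_imp_similar: "orthogonally_similar A B \<Longrightarrow> similar_mat A B"
  unfolding orthogonally_similar_def similar_mat_def by blast

lemma orthogonally_similarI:
  fixes A P :: "'a :: field mat"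
  assumes A: "A \<in> carrier_mat d d" and P: "P \<in> carrier_mat d d" "transpose_mat P * P = 1\<^sub>m d"
  shows "orthogonally_similar A (transpose_mat P * A * P)"
proof -
  have PP: "P * transpose_mat P = 1\<^sub>m d"
    using P by (intro mat_mult_left_right_inverse[of "transpose_mat P" d P]) auto
  have "P * (transpose_mat P * A * P) * transpose_mat P = (P * transpose_mat P) * A * (P * transpose_mat P)"
    using A P(1) by (simp add: assoc_mult_mat[of _ d d _ d _ d])
  then have "A = P * (transpose_mat P * A * P) * transpose_mat P"
    using A PP by simp
  then show ?thesis
    unfolding orthogonally_similar_def
    by (intro exI[of _ P] similar_mat_witI[OF PP P(2)]) (use A P in auto)
qed

lemma orthogonal_transform:
  fixes A P :: "real mat"
  assumes A: "A \<in> carrier_mat d d" "transpose_mat A * A = 1\<^sub>m d"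
    and P: "P \<in> carrier_mat d d" "transpose_mat P * P = 1\<^sub>m d"
  shows "transpose_mat (transpose_mat P * A * P) * (transpose_mat P * A * P) = 1\<^sub>m d"
proof -
  have PP: "P * transpose_mat P = 1\<^sub>m d"
    using P by (intro mat_mult_left_right_inverse[of "transpose_mat P" d P]) auto
  have "transpose_mat (transpose_mat P * A * P) = transpose_mat P * (transpose_mat A * P)"
    using A(1) P(1) by (simp add: transpose_mult[of _ d d _ d])
  then have "transpose_mat (transpose_mat P * A * P) * (transpose_mat P * A * P) =
      transpose_mat P * (transpose_mat A * ((P * transpose_mat P) * (A * P)))"
    using A(1) P(1) by (simp add: assoc_mult_mat[of _ d d _ d _ d])
  also have "\<dots> = transpose_mat P * ((transpose_mat A * A) * P)"
    using A(1) P(1) PP by (simp add: assoc_mult_mat[of _ d d _ d _ d])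
  also have "\<dots> = 1\<^sub>m d"
    using A P by simp
  finally show ?thesis .
qed

section \<open>Blocks of orthogonal matrices and their sizes\<close>

lemma four_block_mat_eqD:
  assumes eq: "four_block_mat A B C D = four_block_mat A' B' C' D'"
    and A: "A \<in> carrier_mat r r'" "A' \<in> carrier_mat r r'"
    and B: "B \<in> carrier_mat r s'" "B' \<in> carrier_mat r s'"
    and C: "C \<in> carrier_mat s r'" "C' \<in> carrier_mat s r'"
    and D: "D \<in> carrier_mat s s'" "D' \<in> carrier_mat s s'"
  shows "A = A' \<and> B = B' \<and> C = C' \<and> D = D'"
proof -
  let ?l = "four_block_mat A B C D" and ?r = "four_block_mat A' B' C' D'"
  have e: "?l $$ (i, j) = ?r $$ (i, j)" for i j by (simp only: eq)
  have "A $$ (i, j) = A' $$ (i, j)" if "i < r" "j < r'" for i j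
    using e[of i j] that assms(2-) by simp
  moreover have "B $$ (i, j) = B' $$ (i, j)" if "i < r" "j < s'" for i j
    using e[of i "j + r'"] that assms(2-) by simp
  moreover have "C $$ (i, j) = C' $$ (i, j)" if "i < s" "j < r'" for i j
    using e[of "i + r" j] that assms(2-) by simp
  moreover have "D $$ (i, j) = D' $$ (i, j)" if "i < s" "j < s'" for i j
    using e[of "i + r" "j + r'"] that assms(2-) by simp
  ultimately show ?thesis using assms(2-) by (intro conjI eq_matI) auto
qed

text \<open>Comparing blocks shows that \<open>B\<close> is orthogonal and that its transpose
  annihilates \<open>X\<close>; as \<open>B\<close> is square, it is invertible and \<open>X\<close>
  vanishes. Geometrically, the orthogonal complement of an invariant subspace is invariant
  too.\<close>

lemma orthogonal_block_lower_left_zero: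
  fixes B X Y :: "real mat"
  assumes c: "B \<in> carrier_mat r r" "X \<in> carrier_mat r s" "Y \<in> carrier_mat s s"
    and orth: "transpose_mat (four_block_mat B X (0\<^sub>m s r) Y) * four_block_mat B X (0\<^sub>m s r) Y = 1\<^sub>m (r + s)"
  shows "X = 0\<^sub>m r s" "transpose_mat Y * Y = 1\<^sub>m s"
proof -
  let ?B = "transpose_mat B" and ?X = "transpose_mat X" and ?Y = "transpose_mat Y"
  have "four_block_mat (1\<^sub>m r) (0\<^sub>m r s) (0\<^sub>m s r) (1\<^sub>m s) =
    four_block_mat ?B (0\<^sub>m r s) ?X ?Y * four_block_mat B X (0\<^sub>m s r) Y"
    using orth c transpose_four_block_mat[OF c(1,2) zero_carrier_mat c(3)] by simp
  also have "\<dots> = four_block_mat (?B * B) (?B * X) (?X * B) (?X * X + ?Y * Y)"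
    using c by (subst mult_four_block_mat[of _ r r _ s _ s _ _ r _ s]) auto
  finally have *: "\<dots> = four_block_mat (1\<^sub>m r) (0\<^sub>m r s) (0\<^sub>m s r) (1\<^sub>m s)" ..
  have "?B * B = 1\<^sub>m r \<and> ?B * X = 0\<^sub>m r s \<and> ?X * B = 0\<^sub>m s r \<and> ?X * X + ?Y * Y = 1\<^sub>m s"
    using c by (intro four_block_mat_eqD[OF *]) auto
  then have e: "?B * B = 1\<^sub>m r" "?B * X = 0\<^sub>m r s" "?X * X + ?Y * Y = 1\<^sub>m s"
    by auto
  have BB: "B * ?B = 1\<^sub>m r"
    using c e(1) by (intro mat_mult_left_right_inverse[of ?B r B]) auto
  have "X = (B * ?B) * X" using c BB by simp
  also have "\<dots> = B * (?B * X)" using c by (simp add: assoc_mult_mat[of _ r r _ r _ s])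
  also have "\<dots> = 0\<^sub>m r s" using c e(2) by (metis right_mult_zero_mat)
  finally show X: "X = 0\<^sub>m r s" .
  show "?Y * Y = 1\<^sub>m s" using e(3) c unfolding X by simp
qed

text \<open>If \<open>r > d\<close>, some unit vector \<open>v\<close> is orthogonal to all
  \<open>d\<close> rows of \<open>V\<close>. Then \<open>V\<close> kills \<open>v\<close>, while
  multiplying by the transpose of \<open>V\<close> gives \<open>v\<close> back, a
  contradiction.\<close>

lemma orthonormal_cols_le:
  fixes V :: "real mat"
  assumes V: "V \<in> carrier_mat d r" and VV: "transpose_mat V * V = 1\<^sub>m r"
  shows "r \<le> d"
proof (rule ccontr)
  assume "\<not> r \<le> d"
  then obtain v where v: "v \<in> carrier_vec r" "v \<bullet> v = 1"
      "\<And>j. j < d \<Longrightarrow> col (transpose_mat V) j \<bullet> v = 0"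
    using ex_unit_vec_orthogonal_cols[of "transpose_mat V" r d] V by auto
  have "V *\<^sub>v v = 0\<^sub>v d"
    using V v by (intro eq_vecI) auto
  then have "(transpose_mat V * V) *\<^sub>v v = transpose_mat V *\<^sub>v 0\<^sub>v d"
    using V v by (simp add: assoc_mult_mat_vec[of _ r d _ r])
  also have "transpose_mat V *\<^sub>v 0\<^sub>v d = 0\<^sub>v r"
    using V by (intro eq_vecI) auto
  finally have "v = 0\<^sub>v r"
    using v VV by simp
  with v show False by simp
qed

lemma char_poly_block_diag:
  fixes A D :: "'a :: idom mat"
  assumes A: "A \<in> carrier_mat r r" and D: "D \<in> carrier_mat s s"
  shows "char_poly (four_block_mat A (0\<^sub>m r s) (0\<^sub>m s r) D) = char_poly A * char_poly D"
proof -
  have "char_poly_matrix (four_block_mat A (0\<^sub>m r s) (0\<^sub>m s r) D) =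
      four_block_mat (char_poly_matrix A) (0\<^sub>m r s) (0\<^sub>m s r) (char_poly_matrix D)"
    using A D by (intro eq_matI) (auto simp: char_poly_matrix_def one_poly_def)
  then show ?thesis
    using A D det_four_block_mat_lower_left_zero[of "char_poly_matrix A" r "0\<^sub>m r s" s "0\<^sub>m s r" "char_poly_matrix D"]
    by (simp add: char_poly_def)
qed

subsection \<open>Splitting off an eigenvalue\<close>

text \<open>Multiplication by \<open>cnj z\<close> on the complex plane in the basis 1, i. This
  choice of sign makes the columns the coordinates of \<open>A a\<close> and \<open>A b\<close> with
  respect to \<open>a\<close>, \<open>b\<close> when \<open>a + i b\<close> is an eigenvector of
  \<open>A\<close> for \<open>z\<close>.\<close>

definition conformal_mat :: "complex \<Rightarrow> real mat" where
  "conformal_mat z = mat 2 2 (\<lambda>(i,j). if i = j then Re z else if i < j then Im z else - Im z)"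

lemma conformal_mat_carrier [simp]: "conformal_mat z \<in> carrier_mat 2 2"
  and dim_conformal_mat [simp]: "dim_row (conformal_mat z) = 2" "dim_col (conformal_mat z) = 2"
  by (simp_all add: conformal_mat_def)

lemma conformal_mat_1: "conformal_mat 1 = 1\<^sub>m 2"
  by (rule eq_matI) (auto simp: conformal_mat_def)

lemma conformal_mat_mult: "conformal_mat z * conformal_mat w = conformal_mat (z * w)"
  by (rule eq_matI)
     (auto simp: conformal_mat_def scalar_prod_def less_2_cases_iff numeral_2_eq_2)

lemma conformal_mat_power: "conformal_mat z ^\<^sub>m n = conformal_mat (z ^ n)"
  by (induction n) (simp_all add: conformal_mat_1 conformal_mat_mult mult.commute)

lemma transpose_conformal_mat: "transpose_mat (conformal_mat z) = conformal_mat (cnj z)"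
  by (rule eq_matI) (auto simp: conformal_mat_def)

lemma det_2x2:
  fixes A :: "'a :: idom mat"
  assumes A: "A \<in> carrier_mat 2 2"
  shows "det A = A $$ (0,0) * A $$ (1,1) - A $$ (0,1) * A $$ (1,0)"
proof -
  have "det A = (\<Sum>i<2. A $$ (i,0) * cofactor A i 0)"
    by (rule laplace_expansion_column[OF A]) simp
  also have "\<dots> = A $$ (0,0) * A $$ (1,1) - A $$ (0,1) * A $$ (1,0)"
    using A by (simp add: cofactor_def mat_delete_def det_single numeral_2_eq_2)
  finally show ?thesis .
qed

lemma det_conformal_mat: "det (conformal_mat z) = (cmod z)\<^sup>2"
  by (simp add: det_2x2 conformal_mat_def cmod_power2 flip: power2_eq_square)

lemma char_poly_conformal_mat: "char_poly (conformal_mat z) = [:(cmod z)\<^sup>2, - 2 * Re z, 1:]"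
  unfolding char_poly_def
  by (subst det_2x2) (auto simp: char_poly_matrix_def conformal_mat_def cmod_power2, simp add: power2_eq_square)

text \<open>A real eigenvalue is only sure to provide an invariant line, hence the block of size 1.
  The block depends on \<open>z\<close> alone, so two matrices with a common eigenvalue split off
  the same block.\<close>

definition eigen_block :: "complex \<Rightarrow> real mat" where
  "eigen_block z = (if Im z = 0 then mat 1 1 (\<lambda>_. Re z) else conformal_mat z)"

lemma eigen_block_carrier: "eigen_block z \<in> carrier_mat (dim_row (eigen_block z)) (dim_row (eigen_block z))"
  by (simp add: eigen_block_def)

lemma dim_eigen_block_pos: "0 < dim_row (eigen_block z)"
  by (simp add: eigen_block_def)

lemma char_poly_eigen_block_real: "Im z = 0 \<Longrightarrow> char_poly (eigen_block z) = [:- Re z, 1:]"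
  by (simp add: eigen_block_def char_poly_def char_poly_matrix_def det_single[of _])

lemma char_poly_eigen_block_nonreal:
  "Im z \<noteq> 0 \<Longrightarrow> char_poly (eigen_block z) = [:(cmod z)\<^sup>2, - 2 * Re z, 1:]"
  by (simp add: eigen_block_def char_poly_conformal_mat)

section \<open>Invariant subspaces from complex eigenvectors\<close>

lemma real_part_mult_mat_vec:
  fixes A :: "real mat" and v :: "complex vec"
  assumes "A \<in> carrier_mat d d" "v \<in> carrier_vec d" "map_mat of_real A *\<^sub>v v = z \<cdot>\<^sub>v v"
  shows "A *\<^sub>v map_vec Re v = Re z \<cdot>\<^sub>v map_vec Re v - Im z \<cdot>\<^sub>v map_vec Im v"
    and "A *\<^sub>v map_vec Im v = Im z \<cdot>\<^sub>v map_vec Re v + Re z \<cdot>\<^sub>v map_vec Im v"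
proof -
  have eq: "(\<Sum>j = 0..<d. of_real (A $$ (i, j)) * v $ j) = z * v $ i" if "i < d" for i
    using arg_cong[OF assms(3), of "\<lambda>w. w $ i"] assms(1,2) that by (simp add: scalar_prod_def)
  show "A *\<^sub>v map_vec Re v = Re z \<cdot>\<^sub>v map_vec Re v - Im z \<cdot>\<^sub>v map_vec Im v"
    using assms(1,2) arg_cong[OF eq, of _ Re] by (intro eq_vecI) (auto simp: scalar_prod_def Re_sum)
  show "A *\<^sub>v map_vec Im v = Im z \<cdot>\<^sub>v map_vec Re v + Re z \<cdot>\<^sub>v map_vec Im v"
    using assms(1,2) arg_cong[OF eq, of _ Im] by (intro eq_vecI) (auto simp: scalar_prod_def Im_sum)
qed

lemma orthogonal_scalar_prod:
  fixes A :: "real mat"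
  assumes A: "A \<in> carrier_mat d d" "transpose_mat A * A = 1\<^sub>m d"
    and v: "v \<in> carrier_vec d" "w \<in> carrier_vec d"
  shows "(A *\<^sub>v v) \<bullet> (A *\<^sub>v w) = v \<bullet> w"
proof -
  have "(A *\<^sub>v v) \<bullet> (A *\<^sub>v w) = (A *\<^sub>v w) \<bullet> (A *\<^sub>v v)"
    using A v by (intro comm_scalar_prod[of _ d]) auto
  also have "\<dots> = (transpose_mat A *\<^sub>v (A *\<^sub>v w)) \<bullet> v"
    using A v by (subst transpose_vec_mult_scalar[of A d d]) auto
  also have "transpose_mat A *\<^sub>v (A *\<^sub>v w) = w"
    using A v by (simp add: assoc_mult_mat_vec[of _ d d _ d, symmetric])
  also have "w \<bullet> v = v \<bullet> w"
    using v by (intro comm_scalar_prod[of _ d]) auto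
  finally show ?thesis .
qed

text \<open>For \<open>v = a + i b\<close> and \<open>z = \<alpha> + i \<beta>\<close>,
  orthogonality gives \<open>v \<bullet> v = z^2 * (v \<bullet> v)\<close> for the bilinear product.
  As \<open>z\<close> is not real, \<open>z^2\<close> differs from 1, so
  \<open>v \<bullet> v = 0\<close>; its real and imaginary parts are the two claims. The proof
  carries this out in real arithmetic.\<close>

lemma nonreal_eigenvector_parts_orthogonal:
  fixes a b :: "real vec"
  assumes A: "A \<in> carrier_mat d d" "transpose_mat A * A = 1\<^sub>m d"
    and ab: "a \<in> carrier_vec d" "b \<in> carrier_vec d"
    and Aa: "A *\<^sub>v a = \<alpha> \<cdot>\<^sub>v a - \<beta> \<cdot>\<^sub>v b" and Ab: "A *\<^sub>v b = \<beta> \<cdot>\<^sub>v a + \<alpha> \<cdot>\<^sub>v b"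
    and "\<beta> \<noteq> 0" and pos: "a \<bullet> a + b \<bullet> b > 0"
  shows "a \<bullet> b = 0" "b \<bullet> b = a \<bullet> a"
proof -
  define X Y Z where "X = a \<bullet> a" and "Y = b \<bullet> b" and "Z = a \<bullet> b"
  have Z': "b \<bullet> a = Z" unfolding Z_def by (rule comm_scalar_prod[OF ab(2,1)])
  note bil = minus_scalar_prod_distrib[of _ d] scalar_prod_minus_distrib[of _ d]
    add_scalar_prod_distrib[of _ d] scalar_prod_add_distrib[of _ d]
    scalar_prod_smult_distrib[of _ d] smult_scalar_prod_distrib[of _ d]
  \<comment> \<open>The three equations expand the invariance under \<open>A\<close> of
    \<open>a \<bullet> a\<close>, \<open>b \<bullet> b\<close> and
    \<open>a \<bullet> b\<close>.\<close>
  have 1: "X = \<alpha>\<^sup>2 * X - 2 * \<alpha> * \<beta> * Z + \<beta>\<^sup>2 * Y"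
    using orthogonal_scalar_prod[OF A ab(1) ab(1)] ab Z'
    by (simp add: Aa bil X_def[symmetric] Y_def[symmetric] Z_def[symmetric] power2_eq_square algebra_simps)
  have 2: "Y = \<beta>\<^sup>2 * X + 2 * \<alpha> * \<beta> * Z + \<alpha>\<^sup>2 * Y"
    using orthogonal_scalar_prod[OF A ab(2) ab(2)] ab Z'
    by (simp add: Ab bil X_def[symmetric] Y_def[symmetric] Z_def[symmetric] power2_eq_square algebra_simps)
  have 3: "Z = \<alpha> * \<beta> * X + (\<alpha>\<^sup>2 - \<beta>\<^sup>2) * Z - \<alpha> * \<beta> * Y"
    using orthogonal_scalar_prod[OF A ab(1) ab(2)] ab Z'
    by (simp add: Aa Ab bil X_def[symmetric] Y_def[symmetric] Z_def[symmetric] power2_eq_square algebra_simps)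
  \<comment> \<open>The sum of the first two equations shows that the eigenvalue has modulus
    1.\<close>
  have "(\<alpha>\<^sup>2 + \<beta>\<^sup>2) * (X + Y) = 1 * (X + Y)" using 1 2 by (simp add: algebra_simps)
  then have n: "\<alpha>\<^sup>2 + \<beta>\<^sup>2 = 1" using pos by (simp only: mult_cancel_right) (simp add: X_def Y_def)
  then have a2: "\<alpha>\<^sup>2 = 1 - \<beta>\<^sup>2" by simp
  have "\<beta> * (\<beta> * X) = \<beta> * (\<beta> * Y - 2 * \<alpha> * Z)"
    using 1 unfolding a2 by (simp add: algebra_simps power2_eq_square)
  then have "\<beta> * X = \<beta> * Y - 2 * \<alpha> * Z" using mult_left_cancel[OF \<open>\<beta> \<noteq> 0\<close>] by blast
  then have e1: "\<beta> * (X - Y) = - 2 * \<alpha> * Z" by (simp add: algebra_simps)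
  have "Z = \<alpha> * \<beta> * (X - Y) + (1 - \<beta>\<^sup>2 - \<beta>\<^sup>2) * Z"
    using 3 unfolding a2 by (simp add: algebra_simps)
  then have "\<beta> * (2 * \<beta> * Z) = \<beta> * (\<alpha> * (X - Y))"
    by (simp add: algebra_simps power2_eq_square)
  then have e2: "2 * \<beta> * Z = \<alpha> * (X - Y)" using \<open>\<beta> \<noteq> 0\<close> by simp
  \<comment> \<open>Eliminating \<open>Z\<close> between \<open>e1\<close> and \<open>e2\<close>
    leaves a multiple of \<open>X - Y\<close> whose coefficient is the squared modulus, that is
    1.\<close>
  have "\<beta>\<^sup>2 * (X - Y) = - \<alpha> * (2 * \<beta> * Z)"
    using arg_cong[OF e1, of "\<lambda>t. \<beta> * t"] by (simp add: algebra_simps power2_eq_square)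
  then have "\<beta>\<^sup>2 * (X - Y) = - \<alpha>\<^sup>2 * (X - Y)"
    unfolding e2 by (simp add: algebra_simps power2_eq_square)
  then have "(\<alpha>\<^sup>2 + \<beta>\<^sup>2) * (X - Y) = 0" by (simp add: algebra_simps)
  then have XY: "X = Y" using n by simp
  then show "b \<bullet> b = a \<bullet> a" by (simp add: X_def Y_def)
  show "a \<bullet> b = 0" using e2 XY \<open>\<beta> \<noteq> 0\<close> by (simp add: Z_def)
qed

text \<open>The columns of \<open>V\<close> are normalised real and imaginary parts of a complex
  eigenvector: both of them if \<open>z\<close> is not real, and a nonzero one of them if
  \<open>z\<close> is real.\<close>

lemma orthonormal_eigen_frame:
  fixes A :: "real mat"
  assumes A: "A \<in> carrier_mat d d" "transpose_mat A * A = 1\<^sub>m d"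
    and z: "poly (map_poly of_real (char_poly A)) (z :: complex) = 0"
  defines "r \<equiv> dim_row (eigen_block z)"
  obtains V where "V \<in> carrier_mat d r" "transpose_mat V * V = 1\<^sub>m r" "A * V = V * eigen_block z"
proof -
  let ?C = "map_mat of_real A :: complex mat"
  have C: "?C \<in> carrier_mat d d" using A by simp
  have "char_poly ?C = map_poly of_real (char_poly A)"
    using of_real_hom.char_poly_hom[OF A(1)] .
  then have "eigenvalue ?C z" using z eigenvalue_root_char_poly[OF C] by simp
  then obtain v where v: "v \<in> carrier_vec d" "v \<noteq> 0\<^sub>v d" "?C *\<^sub>v v = z \<cdot>\<^sub>v v"
    using A unfolding eigenvalue_def eigenvector_def by auto
  define a b where "a = map_vec Re v" and "b = map_vec Im v"
  have ab: "a \<in> carrier_vec d" "b \<in> carrier_vec d" using v by (auto simp: a_def b_def)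
  have Aa: "A *\<^sub>v a = Re z \<cdot>\<^sub>v a - Im z \<cdot>\<^sub>v b" and Ab: "A *\<^sub>v b = Im z \<cdot>\<^sub>v a + Re z \<cdot>\<^sub>v b"
    using real_part_mult_mat_vec[OF A(1) v(1,3)] by (simp_all add: a_def b_def)
  have nz: "a \<noteq> 0\<^sub>v d \<or> b \<noteq> 0\<^sub>v d"
  proof (rule ccontr)
    assume "\<not> ?thesis"
    then have e: "a = 0\<^sub>v d" "b = 0\<^sub>v d" by auto
    have "v $ i = 0" if "i < d" for i
      using arg_cong[OF e(1), of "\<lambda>w. w $ i"] arg_cong[OF e(2), of "\<lambda>w. w $ i"] v(1) that
      by (simp add: a_def b_def complex_eq_iff)
    then show False using v(1,2) by (auto intro!: eq_vecI)
  qed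
  show thesis
  proof (cases "Im z = 0")
    case True
    have "A *\<^sub>v a = Re z \<cdot>\<^sub>v a" "A *\<^sub>v b = Re z \<cdot>\<^sub>v b"
      unfolding Aa Ab using True ab by (auto intro!: eq_vecI)
    then obtain u where u: "u \<in> carrier_vec d" "u \<noteq> 0\<^sub>v d" "A *\<^sub>v u = Re z \<cdot>\<^sub>v u"
      using nz ab by blast
    have pos: "u \<bullet> u > 0"
      using u scalar_prod_self_ge_0[of u] scalar_prod_self_eq_0[OF u(1)] by linarith
    define s where "s = 1 / sqrt (u \<bullet> u)"
    have s: "s * (s * (u \<bullet> u)) = 1" using pos by (simp add: s_def)
    have r: "r = 1" using True by (simp add: r_def eigen_block_def)
    define V where "V = mat d 1 (\<lambda>(i,_). s * u $ i)"
    have V: "V \<in> carrier_mat d 1" and col: "col V 0 = s \<cdot>\<^sub>v u"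
      using u(1) by (auto simp: V_def)
    show ?thesis
    proof (rule that)
      show "V \<in> carrier_mat d r" using V r by simp
      show "transpose_mat V * V = 1\<^sub>m r"
        using u(1) s unfolding r transpose_mult_self_eq_1_iff[OF V] by (simp add: col)
      have "col (A * V) 0 = s \<cdot>\<^sub>v (Re z \<cdot>\<^sub>v u)"
        using u col_mult2[OF A(1) V, of 0] mult_mat_vec[OF A(1) u(1), of s] by (simp add: col)
      moreover have "(A * V) $$ (i, 0) = col (A * V) 0 $ i" if "i < d" for i
        using A(1) V that by simp
      ultimately have "(A * V) $$ (i, 0) = s * (Re z * u $ i)" if "i < d" for i
        using that u(1) by simp
      then show "A * V = V * eigen_block z"
        using A(1) V True
        by (intro eq_matI) (auto simp: eigen_block_def scalar_prod_def V_def)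
    qed
  next
    case False
    have pos: "a \<bullet> a + b \<bullet> b > 0"
      using nz scalar_prod_self_ge_0[of a] scalar_prod_self_eq_0[OF ab(1)]
        scalar_prod_self_ge_0[of b] scalar_prod_self_eq_0[OF ab(2)] by linarith
    note o = nonreal_eigenvector_parts_orthogonal[OF A ab Aa Ab False pos]
    have o': "b \<bullet> a = 0" using o(1) comm_scalar_prod[OF ab] by simp
    \<comment> \<open>Both parts have the same length, so one common factor normalises them and the
      matrix of \<open>A\<close> in these coordinates is unchanged.\<close>
    define s where "s = 1 / sqrt (a \<bullet> a)"
    have s: "s * (s * (a \<bullet> a)) = 1" using pos o(2) by (simp add: s_def)
    have r: "r = 2" using False by (simp add: r_def eigen_block_def)
    define V where "V = mat d 2 (\<lambda>(i,j). s * (if j = 0 then a else b) $ i)"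
    have V: "V \<in> carrier_mat d 2" and col: "col V 0 = s \<cdot>\<^sub>v a" "col V 1 = s \<cdot>\<^sub>v b"
      using ab by (auto simp: V_def)
    show ?thesis
    proof (rule that)
      show "V \<in> carrier_mat d r" using V r by simp
      show "transpose_mat V * V = 1\<^sub>m r"
        using ab s o o' col unfolding r transpose_mult_self_eq_1_iff[OF V]
        by (auto simp: less_2_cases_iff)
      have "col (A * V) 0 = s \<cdot>\<^sub>v (Re z \<cdot>\<^sub>v a - Im z \<cdot>\<^sub>v b)"
           "col (A * V) 1 = s \<cdot>\<^sub>v (Im z \<cdot>\<^sub>v a + Re z \<cdot>\<^sub>v b)"
        using Aa Ab col col_mult2[OF A(1) V, of 0] col_mult2[OF A(1) V, of 1]
          mult_mat_vec[OF A(1) ab(1), of s] mult_mat_vec[OF A(1) ab(2), of s] by simp_all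
      moreover have "(A * V) $$ (i, j) = col (A * V) j $ i" if "i < d" "j < 2" for i j
        using A(1) V that by simp
      ultimately have "(A * V) $$ (i, 0) = s * (Re z * a $ i - Im z * b $ i)"
         "(A * V) $$ (i, 1) = s * (Im z * a $ i + Re z * b $ i)" if "i < d" for i
        using that ab by simp_all
      then show "A * V = V * eigen_block z"
        using A(1) V False
        by (intro eq_matI)
           (auto simp: eigen_block_def conformal_mat_def scalar_prod_def V_def less_2_cases_iff
              numeral_2_eq_2 algebra_simps)
    qed
  qed
qed

text \<open>Complete the frame \<open>V\<close> to an orthogonal \<open>P\<close>. In this basis the
  first \<open>r\<close> columns of \<open>A\<close> are the eigenvalue block above zeros, and
  orthogonality then clears the upper right block.\<close>

lemma orthogonal_split_eigen_block:
  fixes A :: "real mat"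
  assumes A: "A \<in> carrier_mat d d" "transpose_mat A * A = 1\<^sub>m d"
    and z: "poly (map_poly of_real (char_poly A)) (z :: complex) = 0"
  defines "r \<equiv> dim_row (eigen_block z)"
  obtains s Y where "d = r + s" "Y \<in> carrier_mat s s" "transpose_mat Y * Y = 1\<^sub>m s"
    "orthogonally_similar A (four_block_mat (eigen_block z) (0\<^sub>m r s) (0\<^sub>m s r) Y)"
proof -
  let ?B = "eigen_block z"
  have B: "?B \<in> carrier_mat r r" unfolding r_def by (rule eigen_block_carrier)
  obtain V where V: "V \<in> carrier_mat d r" "transpose_mat V * V = 1\<^sub>m r" "A * V = V * ?B"
    using orthonormal_eigen_frame[OF A z] unfolding r_def by blast
  have "r \<le> d" using orthonormal_cols_le[OF V(1,2)] .
  then obtain s where d: "d = r + s" using le_Suc_ex by blast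
  obtain P where P: "P \<in> carrier_mat d d" "transpose_mat P * P = 1\<^sub>m d" "\<forall>j<r. col P j = col V j"
    using orthonormal_completion[OF V(1,2) \<open>r \<le> d\<close>] by blast
  define M where "M = transpose_mat P * A * P"
  have M: "M \<in> carrier_mat d d" using A P by (simp add: M_def)
  \<comment> \<open>Since \<open>P\<close> begins with the columns of \<open>V\<close>, this product
    is an identity matrix above zero rows.\<close>
  have PV: "row (transpose_mat P * V) i = (if i < r then unit_vec r i else 0\<^sub>v r)" if "i < d" for i
  proof (rule eq_vecI)
    fix j assume "j < dim_vec (if i < r then unit_vec r i else 0\<^sub>v r :: real vec)"
    then have j: "j < r" by (auto split: if_splits)
    then have "row (transpose_mat P * V) i $ j = col P i \<bullet> col P j"
      using that P V(1) by simp
    also have "\<dots> = (if i = j then 1 else 0)"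
      using P(2) that j d unfolding transpose_mult_self_eq_1_iff[OF P(1)] by simp
    finally show "row (transpose_mat P * V) i $ j = (if i < r then unit_vec r i else 0\<^sub>v r) $ j"
      using j by auto
  qed (use P V in auto)
  \<comment> \<open>On the first \<open>r\<close> columns \<open>P\<close> may be replaced by
    \<open>V\<close>, and then \<open>A * V\<close> by \<open>V * ?B\<close>.\<close>
  have first: "M $$ (i, j) = (if i < r then ?B $$ (i, j) else 0)" if i: "i < d" and j: "j < r" for i j
  proof -
    have "M $$ (i, j) = row (transpose_mat P) i \<bullet> col (A * P) j"
      using A P i j d unfolding M_def by (simp add: assoc_mult_mat[of _ d d _ d _ d])
    also have "col (A * P) j = col (A * V) j"
      using P(3) j d col_mult2[OF A(1) P(1), of j] col_mult2[OF A(1) V(1), of j] by simp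
    also have "row (transpose_mat P) i \<bullet> col (A * V) j = (transpose_mat P * (V * ?B)) $$ (i, j)"
      using P V B i j by (simp add: V(3))
    also have "\<dots> = row (transpose_mat P * V) i \<bullet> col ?B j"
      unfolding assoc_mult_mat[OF _ V(1) B, of "transpose_mat P" d, symmetric, simplified, OF P(1)]
      using P(1) B i j by (intro index_mult_mat(1)) auto
    also have "\<dots> = (if i < r then ?B $$ (i, j) else 0)"
      using PV[OF i] B j by auto
    finally show ?thesis .
  qed
  define X where "X = mat r s (\<lambda>(i,j). M $$ (i, j + r))"
  define Y where "Y = mat s s (\<lambda>(i,j). M $$ (i + r, j + r))"
  have XY: "X \<in> carrier_mat r s" "Y \<in> carrier_mat s s" by (simp_all add: X_def Y_def)
  have M_eq: "M = four_block_mat ?B X (0\<^sub>m s r) Y"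
    using M B d first by (intro eq_matI) (auto simp: X_def Y_def)
  have "transpose_mat M * M = 1\<^sub>m (r + s)"
    using orthogonal_transform[OF A P(1,2)] unfolding M_def d .
  then have *: "X = 0\<^sub>m r s" "transpose_mat Y * Y = 1\<^sub>m s"
    using orthogonal_block_lower_left_zero[OF B XY] unfolding M_eq by blast+
  have "orthogonally_similar A M"
    unfolding M_def by (rule orthogonally_similarI[OF A(1) P(1,2)])
  then show thesis
    using that[OF d XY(2) *(2)] unfolding M_eq *(1) by blast
qed

section \<open>The characteristic polynomial as a complete invariant\<close>

lemma degree_char_poly:
  fixes A :: "'a :: comm_ring_1 mat"
  shows "A \<in> carrier_mat d d \<Longrightarrow> degree (char_poly A) = d"
  by (rule degree_monic_char_poly[THEN conjunct1])

lemma ex_complex_root_char_poly: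
  fixes A :: "real mat"
  assumes "A \<in> carrier_mat d d" "0 < d"
  obtains z :: complex where "poly (map_poly of_real (char_poly A)) z = 0"
proof -
  have "degree (map_poly of_real (char_poly A) :: complex poly) = d"
    using degree_char_poly[OF assms(1)] by simp
  then have "\<not> constant (poly (map_poly of_real (char_poly A) :: complex poly))"
    using assms(2) by (simp add: constant_degree)
  then show thesis using fundamental_theorem_of_algebra that by blast
qed

lemma char_poly_nonzero:
  fixes A :: "'a :: comm_ring_1 mat"
  shows "A \<in> carrier_mat d d \<Longrightarrow> char_poly A \<noteq> 0"
  using degree_monic_char_poly[of A d] by auto

text \<open>Equality of the polynomials is used twice: it gives a common root, hence a common block,
  and after cancelling the nonzero polynomial of that block it gives the hypothesis for the smaller
  complements.\<close>

lemma orthogonally_similar_if_char_poly_eq: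
  fixes A B :: "real mat"
  assumes "A \<in> carrier_mat d d" "transpose_mat A * A = 1\<^sub>m d"
    and "B \<in> carrier_mat d d" "transpose_mat B * B = 1\<^sub>m d"
    and "char_poly A = char_poly B"
  shows "orthogonally_similar A B"
  using assms
proof (induction d arbitrary: A B rule: less_induct)
  case (less d)
  show ?case
  proof (cases "d = 0")
    case True
    then have "A = 1\<^sub>m 0" "B = 1\<^sub>m 0" using less.prems by auto
    then show ?thesis
      unfolding orthogonally_similar_def
      using similar_mat_wit_refl[of "1\<^sub>m 0" 0] transpose_one[of 0] one_carrier_mat[of 0] by metis
  next
    case False
    then obtain z :: complex where z: "poly (map_poly of_real (char_poly A)) z = 0"
      using ex_complex_root_char_poly[OF less.prems(1)] by blast
    let ?E = "eigen_block z" and ?r = "dim_row (eigen_block z)"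
    note E = eigen_block_carrier[of z]
    obtain s X where X: "d = ?r + s" "X \<in> carrier_mat s s" "transpose_mat X * X = 1\<^sub>m s"
      "orthogonally_similar A (four_block_mat ?E (0\<^sub>m ?r s) (0\<^sub>m s ?r) X)"
      using orthogonal_split_eigen_block[OF less.prems(1,2) z] .
    obtain s' Y where Y': "d = ?r + s'" "Y \<in> carrier_mat s' s'" "transpose_mat Y * Y = 1\<^sub>m s'"
      "orthogonally_similar B (four_block_mat ?E (0\<^sub>m ?r s') (0\<^sub>m s' ?r) Y)"
      using orthogonal_split_eigen_block[OF less.prems(3,4), of z] z less.prems(5) by metis
    have "s' = s" using X(1) Y'(1) by simp
    note Y = Y'[unfolded this]
    have "char_poly ?E * char_poly X = char_poly ?E * char_poly Y"
      using char_poly_block_diag[OF E X(2)] char_poly_block_diag[OF E Y(2)] less.prems(5)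
        char_poly_similar[OF orthogonally_similar_imp_similar[OF X(4)]]
        char_poly_similar[OF orthogonally_similar_imp_similar[OF Y(4)]] by simp
    then have "char_poly X = char_poly Y"
      using char_poly_nonzero[OF E] by simp
    then have "orthogonally_similar X Y"
      using less.IH[OF _ X(2,3) Y(2,3)] X(1) dim_eigen_block_pos[of z] by simp
    from orthogonally_similar_block[OF this E X(2)] show ?thesis
      using X(4) orthogonally_similar_sym[OF Y(4)] orthogonally_similar_trans by blast
  qed
qed

subsection \<open>Products of rotation polynomials\<close>

text \<open>The characteristic polynomial of the plane rotation by the angle
  \<open>2 * pi * j / m\<close>. For \<open>m > 0\<close> and \<open>j \<le> m\<close>, the indices
  \<open>j\<close> and \<open>m - j\<close> give the same polynomial, so for
  \<open>m = 2 * k + 1\<close> the indices up to \<open>k\<close> suffice.\<close>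

definition rotation_poly :: "nat \<Rightarrow> nat \<Rightarrow> real poly" where
  "rotation_poly m j = [:1, - 2 * cos (2 * pi * real j / real m), 1:]"

definition rotation_prod :: "nat \<Rightarrow> nat multiset \<Rightarrow> real poly" where
  "rotation_prod m M = (\<Prod>j\<in>#M. rotation_poly m j)"

lemma rotation_prod_simps [simp]:
  "rotation_prod m {#} = 1"
  "rotation_prod m (add_mset j M) = rotation_poly m j * rotation_prod m M"
  by (simp_all add: rotation_prod_def)

lemma rotation_poly_nonzero: "rotation_poly m j \<noteq> 0"
  by (simp add: rotation_poly_def)

lemma rotation_poly_0: "rotation_poly m 0 = [:-1, 1:] * [:-1, 1:]"
  by (simp add: rotation_poly_def)

section \<open>Odd roots of unity and the shape of the characteristic polynomial\<close>

lemma map_poly_of_real_mult: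
  "map_poly complex_of_real (p * q) = map_poly of_real p * map_poly of_real q"
  by (intro poly_eqI) (simp add: coeff_map_poly coeff_mult)

lemma one_pow_mat: "1\<^sub>m d ^\<^sub>m i = (1\<^sub>m d :: 'a :: semiring_1 mat)"
  by (induction i) auto

text \<open>Write \<open>z\<close> as \<open>cis (2 * pi * j / m)\<close> with \<open>j < m\<close>.
  An index above \<open>k\<close> is reflected to \<open>m - j\<close>, which conjugates
  \<open>z\<close> and keeps its real part.\<close>

lemma root_of_unity_real_part:
  assumes "z ^ (2 * k + 1) = (1 :: complex)"
  shows "\<exists>j\<le>k. Re z = cos (2 * pi * real j / real (2 * k + 1))"
proof -
  define m where "m = 2 * k + 1"
  have "z \<in> {z. z ^ m = 1}" using assms by (simp add: m_def)
  then obtain j where j: "j < m" "z = cis (2 * pi * real j / real m)"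
    using bij_betw_roots_unity[of m] unfolding bij_betw_def m_def by auto
  show ?thesis
  proof (cases "j \<le> k")
    case True
    then show ?thesis using j unfolding m_def by auto
  next
    case False
    have "2 * pi * real (m - j) / real m = 2 * pi - 2 * pi * real j / real m"
      using j(1) by (simp add: of_nat_diff field_simps)
    then have "cos (2 * pi * real (m - j) / real m) = Re z"
      using j(2) by simp
    then show ?thesis using False j(1) unfolding m_def by (intro exI[of _ "2 * k + 1 - j"]) auto
  qed
qed

text \<open>The odd exponent excludes -1, so 1 is the only real eigenvalue that can occur.\<close>

lemma real_root_of_unity_odd:
  assumes "z ^ (2 * k + 1) = (1 :: complex)" "Im z = 0"
  shows "Re z = 1"
proof -
  have z: "z = of_real (Re z)" using assms(2) by (simp add: complex_eq_iff)
  have "complex_of_real (Re z ^ (2 * k + 1)) = 1" using assms(1) z by (metis of_real_power)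
  then have "Re z ^ (2 * k + 1) = 1 ^ (2 * k + 1)" by (metis of_real_eq_1_iff power_one)
  then show ?thesis
    using odd_real_root_power_cancel[of "2 * k + 1" "Re z"] odd_real_root_power_cancel[of "2 * k + 1" 1]
    by simp
qed

text \<open>Eigenvalues are split off one block at a time. The bound \<open>a \<le> 1\<close>
  normalises the factorisation: a second unpaired eigenvalue 1 is joined with the first into the
  factor of index 0, so \<open>a\<close> is just the parity of \<open>d\<close>.\<close>

lemma char_poly_orthogonal_root_of_unity:
  fixes A :: "real mat"
  assumes "A \<in> carrier_mat d d" "transpose_mat A * A = 1\<^sub>m d"
    and "\<And>z :: complex. poly (map_poly of_real (char_poly A)) z = 0 \<Longrightarrow> z ^ (2 * k + 1) = 1"
  shows "\<exists>a M. a \<le> 1 \<and> set_mset M \<subseteq> {..k} \<and> a + 2 * size M = d \<and>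
    char_poly A = [:-1, 1:] ^ a * rotation_prod (2 * k + 1) M"
  using assms
proof (induction d arbitrary: A rule: less_induct)
  case (less d)
  show ?case
  proof (cases "d = 0")
    case True
    then have "char_poly A = 1"
      using less.prems(1) unfolding char_poly_def by (intro det_dim_zero) simp
    then show ?thesis using True by (intro exI[of _ 0] exI[of _ "{#}"]) simp
  next
    case False
    then obtain z :: complex where z: "poly (map_poly of_real (char_poly A)) z = 0"
      using ex_complex_root_char_poly[OF less.prems(1)] by blast
    let ?E = "eigen_block z" and ?r = "dim_row (eigen_block z)"
    note E = eigen_block_carrier[of z]
    obtain s Y where Y: "d = ?r + s" "Y \<in> carrier_mat s s" "transpose_mat Y * Y = 1\<^sub>m s"
      "orthogonally_similar A (four_block_mat ?E (0\<^sub>m ?r s) (0\<^sub>m s ?r) Y)"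
      using orthogonal_split_eigen_block[OF less.prems(1,2) z] .
    have cp: "char_poly A = char_poly ?E * char_poly Y"
      using char_poly_block_diag[OF E Y(2)]
        char_poly_similar[OF orthogonally_similar_imp_similar[OF Y(4)]] by simp
    have "w ^ (2 * k + 1) = 1" if "poly (map_poly of_real (char_poly Y)) w = 0" for w :: complex
      using that by (intro less.prems(3)) (simp add: cp map_poly_of_real_mult)
    moreover have "s < d" using Y(1) dim_eigen_block_pos[of z] by simp
    ultimately obtain a M where aM: "a \<le> 1" "set_mset M \<subseteq> {..k}" "a + 2 * size M = s"
      "char_poly Y = [:-1, 1:] ^ a * rotation_prod (2 * k + 1) M"
      using less.IH[OF _ Y(2,3)] by blast
    note z1 = less.prems(3)[OF z]
    show ?thesis
    proof (cases "Im z = 0")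
      case True
      have r: "?r = 1" using True by (simp add: eigen_block_def)
      have e: "char_poly ?E = [:-1, 1:]"
        using char_poly_eigen_block_real[OF True] real_root_of_unity_odd[OF z1 True] by simp
      show ?thesis
      proof (cases "a = 0")
        case True
        then show ?thesis
          using aM Y(1) r cp e by (intro exI[of _ 1] exI[of _ M]) simp
      next
        case False
        then have a: "a = 1" using aM(1) by simp
        \<comment> \<open>The new factor \<open>X - 1\<close> and the one left over from
          \<open>Y\<close> form \<open>rotation_poly\<close> at index 0.\<close>
        have "char_poly A = [:-1, 1:] ^ 0 * rotation_prod (2 * k + 1) (add_mset 0 M)"
          by (simp only: cp e aM(4) a rotation_prod_simps rotation_poly_0 power_one_right power_0 mult_1_left mult.assoc)
        then show ?thesis
          using aM(2,3) a Y(1) r by (intro exI[of _ 0] exI[of _ "add_mset 0 M"]) simp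
      qed
    next
      case False
      obtain j where j: "j \<le> k" "Re z = cos (2 * pi * real j / real (2 * k + 1))"
        using root_of_unity_real_part[OF z1] by blast
      have "cmod z ^ (2 * k + 1) = 1" using z1 by (metis norm_one norm_power)
      then have "cmod z = 1" using power_eq_imp_eq_base[of "cmod z" "2 * k + 1" 1] by simp
      then have e: "char_poly ?E = rotation_poly (2 * k + 1) j"
        using char_poly_eigen_block_nonreal[OF False] j(2) by (simp add: rotation_poly_def)
      have r: "?r = 2" using False by (simp add: eigen_block_def)
      have "char_poly A = [:-1, 1:] ^ a * rotation_prod (2 * k + 1) (add_mset j M)"
        by (simp only: cp e aM(4) rotation_prod_simps mult.left_commute)
      then show ?thesis
        using aM(1-3) Y(1) r j(1) by (intro exI[of _ a] exI[of _ "add_mset j M"]) simp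
    qed
  qed
qed

text \<open>Factor \<open>X\<close> out of \<open>X^2 - 2 c X + 1\<close> and use
  \<open>X + 1/X = 2 cos t\<close> at \<open>X = cis t\<close>. A point of the unit circle is thus a
  root exactly when the cosines agree.\<close>

lemma poly_rotation_poly_cis:
  "poly (map_poly of_real (rotation_poly m i)) (cis t) =
     cis t * of_real (2 * cos t - 2 * cos (2 * pi * real i / real m))"
proof -
  have "(sin t)\<^sup>2 = 1 - (cos t)\<^sup>2" by (rule sin_squared_eq)
  then show ?thesis
    by (simp add: rotation_poly_def complex_eq_iff algebra_simps power2_eq_square)
qed

text \<open>The angles of the indices up to \<open>k\<close> lie between 0 and \<open>pi\<close>,
  where the cosine is injective. So a root of this form determines the index of the factor that
  vanishes there.\<close>

lemma rotation_prod_root_mem: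
  assumes "poly (map_poly of_real (rotation_prod m M)) (cis (2 * pi * real j / real m)) = 0"
    and "set_mset M \<subseteq> {..k}" "j \<le> k" "m = 2 * k + 1"
  shows "j \<in># M"
  using assms(1,2)
proof (induction M)
  case (add i M)
  let ?t = "\<lambda>i. 2 * pi * real i / real m"
  have range: "?t i \<in> {0..pi}" if "i \<le> k" for i
  proof -
    have "2 * pi * real i \<le> pi * real m" using that \<open>m = 2 * k + 1\<close> by simp
    then show ?thesis using \<open>m = 2 * k + 1\<close> by (simp add: field_simps)
  qed
  from add.prems(1) have "poly (map_poly of_real (rotation_poly m i)) (cis (?t j)) = 0 \<or>
      poly (map_poly of_real (rotation_prod m M)) (cis (?t j)) = 0"
    by (simp add: map_poly_of_real_mult)
  then show ?case
  proof
    assume "poly (map_poly of_real (rotation_poly m i)) (cis (?t j)) = 0"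
    then have "complex_of_real (2 * cos (?t j) - 2 * cos (?t i)) = 0"
      unfolding poly_rotation_poly_cis mult_eq_0_iff by (simp only: cis_neq_zero simp_thms)
    then have "2 * cos (?t j) - 2 * cos (?t i) = 0" by (simp only: of_real_eq_0_iff)
    then have "cos (?t j) = cos (?t i)" by linarith
    then have "?t j = ?t i"
      using range[of i] range[of j] add.prems(2) assms(3) by - (rule cos_inj_pi, auto)
    moreover have "m > 0" using assms(4) by simp
    ultimately have "j = i" by simp
    then show ?thesis by simp
  qed (use add in auto)
qed simp

text \<open>A root belonging to an index of \<open>M\<close> forces the same index into
  \<open>M'\<close>; the common nonzero factor is cancelled. Equality of sizes settles the empty
  case.\<close>

lemma rotation_prod_inj:
  assumes "rotation_prod m M = rotation_prod m M'"
    and "set_mset M \<subseteq> {..k}" "set_mset M' \<subseteq> {..k}" "size M = size M'" "m = 2 * k + 1"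
  shows "M = M'"
  using assms(1-4)
proof (induction M arbitrary: M')
  case (add j M)
  let ?z = "cis (2 * pi * real j / real m)"
  have "poly (map_poly of_real (rotation_prod m (add_mset j M))) ?z = 0"
    by (simp add: map_poly_of_real_mult poly_rotation_poly_cis)
  then have "j \<in># M'"
    using rotation_prod_root_mem[of m M' j k] add.prems \<open>m = 2 * k + 1\<close> by simp
  then obtain N where N: "M' = add_mset j N" by (metis insert_DiffM)
  then have "rotation_prod m M = rotation_prod m N"
    using add.prems(1) rotation_poly_nonzero by simp
  then show ?case using add.IH[of N] add.prems N by simp
qed simp

text \<open>The witness is block diagonal: a single entry 1 and, for each index of \<open>M\<close>
  with multiplicity, a rotation block of order dividing \<open>m\<close>. Index 0 contributes a 2 by
  2 identity block.\<close>

lemma ex_orthogonal_rotation_prod: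
  fixes M :: "nat multiset"
  assumes "m > 0"
  shows "\<exists>A. A \<in> carrier_mat (2 * size M + 1) (2 * size M + 1) \<and>
    transpose_mat A * A = 1\<^sub>m (2 * size M + 1) \<and> det A = 1 \<and> A ^\<^sub>m m = 1\<^sub>m (2 * size M + 1) \<and>
    char_poly A = [:-1, 1:] * rotation_prod m M"
proof (induction M)
  case empty
  have "char_poly (1\<^sub>m 1 :: real mat) = [:-1, 1:]"
    by (simp add: char_poly_def char_poly_matrix_def det_single)
  then show ?case by (intro exI[of _ "1\<^sub>m 1"]) (simp add: one_pow_mat)
next
  case (add j M)
  define N where "N = 2 * size M + 1"
  obtain A where A: "A \<in> carrier_mat N N" "transpose_mat A * A = 1\<^sub>m N" "det A = 1"
      "A ^\<^sub>m m = 1\<^sub>m N" "char_poly A = [:-1, 1:] * rotation_prod m M"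
    using add unfolding N_def by blast
  define z where "z = cis (2 * pi * real j / real m)"
  let ?R = "conformal_mat z"
  let ?A = "four_block_mat ?R (0\<^sub>m 2 N) (0\<^sub>m N 2) A"
  have "z ^ m = cis (2 * pi * real j)"
    using \<open>m > 0\<close> by (simp add: z_def DeMoivre)
  then have zm: "z ^ m = 1" by (simp add: cis_multiple_2pi)
  have zn: "cmod z = 1" "cnj z * z = 1"
    by (simp_all add: z_def cis_cnj cis_mult)
  have dim: "2 * size (add_mset j M) + 1 = 2 + N" by (simp add: N_def)
  have c: "?A \<in> carrier_mat (2 + N) (2 + N)"
    by (rule four_block_carrier_mat[OF conformal_mat_carrier A(1)])
  have "transpose_mat ?A * ?A = four_block_mat (conformal_mat (cnj z)) (0\<^sub>m 2 N) (0\<^sub>m N 2) (transpose_mat A) * ?A"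
    using A(1) by (subst transpose_four_block_mat[of _ 2 2 _ N _ N]) (auto simp: transpose_conformal_mat)
  also have "\<dots> = 1\<^sub>m (2 + N)"
    using A(1,2) zn
    by (subst mult_four_block_mat[of _ 2 2 _ N _ N _ _ 2 _ N])
       (auto simp: conformal_mat_mult conformal_mat_1)
  finally have o: "transpose_mat ?A * ?A = 1\<^sub>m (2 + N)" .
  have d: "det ?A = 1"
    using det_four_block_mat_lower_left_zero[OF conformal_mat_carrier[of z] zero_carrier_mat refl A(1)]
      A(3) zn by (simp add: det_conformal_mat)
  have p: "?A ^\<^sub>m m = 1\<^sub>m (2 + N)"
    using pow_four_block_mat[OF conformal_mat_carrier A(1)] A(4) zm
    by (simp add: conformal_mat_power conformal_mat_1)
  have "char_poly ?A = char_poly ?R * char_poly A"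
    by (rule char_poly_block_diag[OF conformal_mat_carrier A(1)])
  also have "char_poly ?R = rotation_poly m j"
    using zn by (simp add: char_poly_conformal_mat rotation_poly_def z_def)
  finally have "char_poly ?A = [:-1, 1:] * rotation_prod m (add_mset j M)"
    using A(5) by (simp only: rotation_prod_simps ac_simps)
  with c o d p show ?case unfolding dim by blast
qed

text \<open>On an eigenvector for \<open>z\<close>, the \<open>m\<close>-th power of the matrix acts
  both as the identity and as \<open>z ^ m\<close>.\<close>

lemma char_poly_root_if_pow_eq_1:
  fixes A :: "real mat" and z :: complex
  assumes A: "A \<in> carrier_mat d d" "A ^\<^sub>m m = 1\<^sub>m d"
    and z: "poly (map_poly of_real (char_poly A)) z = 0"
  shows "z ^ m = 1"
proof -
  let ?C = "map_mat of_real A :: complex mat"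
  have C: "?C \<in> carrier_mat d d" using A by simp
  have "char_poly ?C = map_poly of_real (char_poly A)"
    using of_real_hom.char_poly_hom[OF A(1)] .
  then have "eigenvalue ?C z" using z eigenvalue_root_char_poly[OF C] by simp
  then obtain v where ev: "eigenvector ?C v z" unfolding eigenvalue_def by blast
  then have v: "v \<in> carrier_vec d" "v \<noteq> 0\<^sub>v d" using A by (auto simp: eigenvector_def)
  have "?C ^\<^sub>m m = 1\<^sub>m d"
    using of_real_hom.mat_hom_pow[OF A(1), of m] A(2) of_real_hom.mat_hom_one by metis
  then have "v = z ^ m \<cdot>\<^sub>v v"
    using eigenvector_pow[OF C ev, of m] v by simp
  obtain i where i: "i < d" "v $ i \<noteq> 0" using v by (metis eq_vecI carrier_vecD index_zero_vec)
  have "v $ i = z ^ m * v $ i"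
    using arg_cong[OF \<open>v = z ^ m \<cdot>\<^sub>v v\<close>, of "\<lambda>w. w $ i"] i v by simp
  then show ?thesis using i by simp
qed

text \<open>Stars and bars: a multiset on \<open>{..k}\<close> is the same as its list of
  \<open>k + 1\<close> multiplicities, which sum to \<open>n\<close>.\<close>

lemma card_multisets_of_size:
  "card {M. set_mset M \<subseteq> {..k} \<and> size M = n} = (n + k) choose k"
proof -
  let ?S = "{M. set_mset M \<subseteq> {..k} \<and> size M = n}"
  let ?L = "{l :: nat list. length l = k + 1 \<and> sum_list l = n}"
  let ?f = "\<lambda>M. map (count M) [0..<k+1]"
  have sum: "sum_list (?f M) = size M" if "set_mset M \<subseteq> {..k}" for M
  proof -
    have "sum_list (?f M) = (\<Sum>i\<in>{..k}. count M i)"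
      by (simp add: interv_sum_list_conv_sum_set_nat atLeast0LessThan lessThan_Suc_atMost del: upt_Suc)
    also have "\<dots> = (\<Sum>i\<in>set_mset M. count M i)"
      using that by (intro sum.mono_neutral_right) (auto simp: not_in_iff)
    finally show ?thesis by (simp add: size_multiset_overloaded_eq)
  qed
  have "bij_betw ?f ?S ?L"
  proof (intro bij_betwI')
    fix M M' assume M: "M \<in> ?S" "M' \<in> ?S"
    show "(?f M = ?f M') = (M = M')"
    proof
      assume eq: "?f M = ?f M'"
      show "M = M'"
      proof (rule multiset_eqI)
        fix i
        show "count M i = count M' i"
        proof (cases "i \<le> k")
          case True
          then show ?thesis using eq by (simp del: upt_Suc)
        next
          case False
          then have "i \<notin># M" "i \<notin># M'" using M by auto
          then show ?thesis by (simp add: not_in_iff)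
        qed
      qed
    qed simp
  next
    fix M assume "M \<in> ?S"
    then show "?f M \<in> ?L" using sum[of M] by (simp del: upt_Suc)
  next
    fix l assume l: "l \<in> ?L"
    \<comment> \<open>The inverse map: the multiset with multiplicities prescribed by
      \<open>l\<close>.\<close>
    define M where "M = (\<Sum>i\<in>{..k}. replicate_mset (l ! i) i)"
    have cnt: "count M i = (if i \<le> k then l ! i else 0)" for i
      by (auto simp: M_def count_sum if_distrib)
    then have sub: "set_mset M \<subseteq> {..k}" by (auto simp flip: count_greater_zero_iff split: if_splits)
    have "?f M = l" using l cnt by (intro nth_equalityI) (auto simp del: upt_Suc)
    then show "\<exists>M\<in>?S. l = ?f M" using l sub sum[OF sub] by (intro bexI[of _ M]) auto
  qed
  then have "card ?S = (n + (k + 1) - 1) choose n"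
    using card_length_sum_list[of "k + 1" n] by (simp only: bij_betw_same_card)
  also have "\<dots> = (n + k) choose k"
    using binomial_symmetric[of k "n + k"] by simp
  finally show ?thesis .
qed

subsection \<open>Conjugacy classes of the special orthogonal group\<close>

lemma carrier_SO_iff:
  "A \<in> carrier (SO N) \<longleftrightarrow> A \<in> carrier_mat N N \<and> transpose_mat A * A = 1\<^sub>m N \<and> det A = 1"
  by (simp add: SO_def)

lemma inv_SO: "A \<in> carrier (SO N) \<Longrightarrow> inv\<^bsub>SO N\<^esub> A = transpose_mat A"
proof -
  assume A: "A \<in> carrier (SO N)"
  then have "A * transpose_mat A = 1\<^sub>m N"
    by (intro mat_mult_left_right_inverse[of "transpose_mat A" N A]) (auto simp: carrier_SO_iff)
  then have "transpose_mat A \<in> carrier (SO N)"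
    using A by (auto simp: carrier_SO_iff det_transpose)
  then show ?thesis
    using A by (intro group.inv_equality[OF group_SO]) (auto simp: SO_def)
qed

lemma nat_pow_SO: "A [^]\<^bsub>SO N\<^esub> (i :: nat) = A ^\<^sub>m i" if "A \<in> carrier (SO N)"
proof (induction i)
  case 0
  then show ?case using that by (auto simp: SO_def nat_pow_def)
next
  case (Suc i)
  have "A [^]\<^bsub>SO N\<^esub> Suc i = A [^]\<^bsub>SO N\<^esub> i * A"
    by (simp add: nat_pow_def SO_def)
  then show ?case using Suc by simp
qed

text \<open>In odd dimension \<open>- 1\<close> has determinant \<open>- 1\<close>, so conjugation by an orthogonal matrix
  is also conjugation by a special orthogonal one.\<close>

lemma orthogonally_similar_imp_SO_conjugate:
  assumes "odd N" and B: "B \<in> carrier_mat N N" and "orthogonally_similar B A"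
  obtains g where "g \<in> carrier (SO N)" "B = g * A * transpose_mat g"
proof -
  obtain P where "similar_mat_wit B A P (transpose_mat P)"
    using assms(3) unfolding orthogonally_similar_def by blast
  from similar_mat_witD2[OF B this]
  have A: "A \<in> carrier_mat N N" and P: "P \<in> carrier_mat N N" "transpose_mat P * P = 1\<^sub>m N"
    and BP: "B = P * A * transpose_mat P" by auto
  have "det P * det P = 1"
    using arg_cong[OF P(2), of det] P(1) det_mult[of "transpose_mat P" N P] by (simp add: det_transpose)
  then consider "det P = 1" | "det P = -1" by (auto simp: square_eq_1_iff)
  then show thesis
  proof cases
    case 1
    then show ?thesis using that[of P] P BP by (simp add: carrier_SO_iff)
  next
    case 2
    let ?Q = "-1 \<cdot>\<^sub>m P"
    have T: "transpose_mat ?Q = -1 \<cdot>\<^sub>m transpose_mat P" by (intro eq_matI) auto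
    have neg: "(-1 \<cdot>\<^sub>m X) * (-1 \<cdot>\<^sub>m Y) = X * Y" if "X \<in> carrier_mat N N" "Y \<in> carrier_mat N N" for X Y :: "real mat"
      using that by (intro eq_matI) auto
    have "det ?Q = 1" using P(1) assms(1) 2 by simp
    moreover have "transpose_mat ?Q * ?Q = 1\<^sub>m N"
      unfolding T using neg[of "transpose_mat P" P] P by simp
    moreover have "?Q * A * transpose_mat ?Q = P * A * transpose_mat P"
      unfolding T mult_smult_assoc_mat[OF P(1) A] using neg[of "P * A" "transpose_mat P"] P A by simp
    ultimately show ?thesis using that[of ?Q] P(1) BP by (simp add: carrier_SO_iff)
  qed
qed

text \<open>Conjugation preserves the characteristic polynomial. Conversely, equal polynomials give
  an orthogonal conjugator, and odd \<open>N\<close> allows it to be chosen with determinant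
  1.\<close>

lemma SO_conjugacy_class_eq:
  assumes "odd N" and A: "A \<in> carrier (SO N)"
  shows "orbit (SO N) (\<lambda>g. \<lambda>h\<in>carrier (SO N). g \<otimes>\<^bsub>SO N\<^esub> h \<otimes>\<^bsub>SO N\<^esub> inv\<^bsub>SO N\<^esub> g) A =
    {B \<in> carrier (SO N). char_poly B = char_poly A}" (is "?O = ?R")
proof -
  interpret group "SO N" by (rule group_SO)
  have mult: "g \<otimes>\<^bsub>SO N\<^esub> h = g * h" for g h by (simp add: SO_def)
  have orbit: "?O = {g * A * transpose_mat g | g. g \<in> carrier (SO N)}"
    using A by (auto simp: orbit_def mult inv_SO) (metis inv_SO)
  show ?thesis
  proof (intro equalityI subsetI)
    fix B assume "B \<in> ?O"
    then obtain g where g: "g \<in> carrier (SO N)" "B = g * A * transpose_mat g"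
      unfolding orbit by blast
    have "g \<otimes>\<^bsub>SO N\<^esub> A \<otimes>\<^bsub>SO N\<^esub> inv\<^bsub>SO N\<^esub> g \<in> carrier (SO N)"
      using g(1) A by (intro m_closed inv_closed)
    then have B: "B \<in> carrier (SO N)" using g by (simp add: mult inv_SO)
    have gT: "g * transpose_mat g = 1\<^sub>m N"
      using g(1) by (intro mat_mult_left_right_inverse[of "transpose_mat g" N g]) (auto simp: carrier_SO_iff)
    have "similar_mat_wit B A g (transpose_mat g)"
      using g A B by (intro similar_mat_witI[OF gT]) (auto simp: carrier_SO_iff)
    then have "char_poly B = char_poly A"
      by (intro char_poly_similar) (auto simp: similar_mat_def)
    then show "B \<in> ?R" using B by simp
  next
    fix B assume "B \<in> ?R"
    then have "orthogonally_similar B A" "B \<in> carrier_mat N N"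
      using A by (auto simp: carrier_SO_iff intro: orthogonally_similar_if_char_poly_eq)
    then obtain g where "g \<in> carrier (SO N)" "B = g * A * transpose_mat g"
      using orthogonally_similar_imp_SO_conjugate[OF assms(1)] by blast
    then show "B \<in> ?O" unfolding orbit by blast
  qed
qed

text \<open>One inclusion is the factorisation over roots of unity, the other the block diagonal
  construction. Together they reduce the count of classes to a count of multisets.\<close>

lemma char_poly_torsion_SO:
  assumes "m = 2 * k + 1"
  shows "char_poly ` {A \<in> carrier (SO (2 * n + 1)). A ^\<^sub>m m = 1\<^sub>m (2 * n + 1)} =
    (\<lambda>M. [:-1, 1:] * rotation_prod m M) ` {M. set_mset M \<subseteq> {..k} \<and> size M = n}"
    (is "char_poly ` ?S = ?f ` ?T")
proof (intro equalityI subsetI)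
  fix p assume "p \<in> char_poly ` ?S"
  then obtain A where A: "A \<in> carrier_mat (2 * n + 1) (2 * n + 1)"
      "transpose_mat A * A = 1\<^sub>m (2 * n + 1)" "A ^\<^sub>m m = 1\<^sub>m (2 * n + 1)" "p = char_poly A"
    by (auto simp: carrier_SO_iff)
  obtain a M where M: "a \<le> 1" "set_mset M \<subseteq> {..k}" "a + 2 * size M = 2 * n + 1"
      "char_poly A = [:-1, 1:] ^ a * rotation_prod m M"
    using char_poly_orthogonal_root_of_unity[OF A(1,2), of k] char_poly_root_if_pow_eq_1[OF A(1,3)]
    unfolding assms by blast
  \<comment> \<open>The dimension is odd, so exactly one eigenvalue 1 stays unpaired.\<close>
  have "a = 1" using M(1,3) by presburger
  then have "M \<in> ?T" "p = ?f M" using M A(4) by (simp_all only: power_one_right) auto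
  then show "p \<in> ?f ` ?T" by blast
next
  fix p assume "p \<in> ?f ` ?T"
  then obtain M where M: "size M = n" "p = ?f M" by blast
  obtain A where "A \<in> carrier_mat (2 * n + 1) (2 * n + 1)"
      "transpose_mat A * A = 1\<^sub>m (2 * n + 1)" "det A = 1" "A ^\<^sub>m m = 1\<^sub>m (2 * n + 1)" "char_poly A = ?f M"
    using ex_orthogonal_rotation_prod[of m M] assms M(1) by auto
  then have "A \<in> ?S" "p = char_poly A" using M(2) by (simp_all only: carrier_SO_iff mem_Collect_eq simp_thms)
  then show "p \<in> char_poly ` ?S" by blast
qed

theorem theorem9:
  fixes n m k :: nat
  assumes "n \<ge> 1" and "m = 2 * k + 1"
  shows "num_classes (SO (2 * n + 1)) m = (n + m div 2) choose (m div 2)"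
proof -
  define N where "N = 2 * n + 1"
  have "odd N" by (simp add: N_def)
  let ?G = "SO N"
  let ?orb = "orbit ?G (\<lambda>g. \<lambda>h\<in>carrier ?G. g \<otimes>\<^bsub>?G\<^esub> h \<otimes>\<^bsub>?G\<^esub> inv\<^bsub>?G\<^esub> g)"
  let ?S = "{A \<in> carrier ?G. A ^\<^sub>m m = 1\<^sub>m N}"
  define cls where "cls p = {B \<in> carrier ?G. char_poly B = p}" for p
  have orb: "?orb A = cls (char_poly A)" if "A \<in> carrier ?G" for A
    unfolding cls_def by (rule SO_conjugacy_class_eq[OF \<open>odd N\<close> that])
  have tors: "{A \<in> carrier ?G. A [^]\<^bsub>?G\<^esub> m = \<one>\<^bsub>?G\<^esub>} = ?S"
    using nat_pow_SO[of _ N m] by (auto simp: SO_def)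
  \<comment> \<open>The torsion condition is invariant under conjugation, so a class that meets
    \<open>?S\<close> lies in it.\<close>
  have closed: "cls (char_poly A) \<subseteq> ?S" if A: "A \<in> ?S" for A
  proof
    fix B assume "B \<in> cls (char_poly A)"
    then have B: "B \<in> carrier ?G" and "char_poly B = char_poly A" by (auto simp: cls_def)
    then have "orthogonally_similar B A"
      using A by (intro orthogonally_similar_if_char_poly_eq[of _ N]) (auto simp: carrier_SO_iff)
    then obtain P where P: "similar_mat_wit B A P (transpose_mat P)"
      unfolding orthogonally_similar_def by blast
    have BN: "B \<in> carrier_mat N N" using B by (simp add: carrier_SO_iff)
    have "B ^\<^sub>m m = P * 1\<^sub>m N * transpose_mat P"
      using similar_mat_wit_pow_id[OF P, of m] A by simp
    also have "\<dots> = 1\<^sub>m N"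
      using similar_mat_witD2(1,6)[OF BN P] by simp
    finally show "B \<in> ?S" using B by simp
  qed
  have "{C \<in> conjugacy_classes ?G. C \<subseteq> ?S} = (\<lambda>A. cls (char_poly A)) ` ?S"
  proof (intro equalityI subsetI)
    fix C assume "C \<in> {C \<in> conjugacy_classes ?G. C \<subseteq> ?S}"
    then obtain A where A: "A \<in> carrier ?G" "C = cls (char_poly A)" "C \<subseteq> ?S"
      unfolding conjugacy_classes_def orbits_def using orb by auto
    then have "A \<in> C" by (simp add: cls_def)
    with A show "C \<in> (\<lambda>A. cls (char_poly A)) ` ?S" by blast
  next
    fix C assume "C \<in> (\<lambda>A. cls (char_poly A)) ` ?S"
    then obtain A where A: "A \<in> ?S" "C = cls (char_poly A)" by blast
    then show "C \<in> {C \<in> conjugacy_classes ?G. C \<subseteq> ?S}"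
      using closed[OF A(1)] orb[of A] unfolding conjugacy_classes_def orbits_def by blast
  qed
  then have "num_classes ?G m = card (cls ` (char_poly ` ?S))"
    unfolding num_classes_def tors by (simp add: image_image)
  also have "\<dots> = card (char_poly ` ?S)"
    \<comment> \<open>Each of these sets contains a matrix with the given polynomial; being
      nonempty, it determines that polynomial.\<close>
    by (intro card_image inj_onI) (auto simp: cls_def)
  also have "\<dots> = card {M. set_mset M \<subseteq> {..k} \<and> size M = n}"
  proof -
    have "inj_on (\<lambda>M. [:-1, 1:] * rotation_prod m M) {M. set_mset M \<subseteq> {..k} \<and> size M = n}"
    proof (rule inj_onI)
      fix M M'
      assume M: "M \<in> {M. set_mset M \<subseteq> {..k} \<and> size M = n}" "M' \<in> {M. set_mset M \<subseteq> {..k} \<and> size M = n}"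
        and "[:-1, 1:] * rotation_prod m M = [:-1, 1:] * rotation_prod m M'"
      then have "rotation_prod m M = rotation_prod m M'"
        by (subst (asm) mult_cancel_left) simp
      then show "M = M'" using rotation_prod_inj[OF _ _ _ _ assms(2)] M by auto
    qed
    then show ?thesis
      unfolding N_def char_poly_torsion_SO[OF assms(2)] by (rule card_image)
  qed
  also have "\<dots> = (n + k) choose k" by (rule card_multisets_of_size)
  also have "k = m div 2" using assms(2) by simp
  finally show ?thesis unfolding N_def .
qed

end
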